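(* Let $m\ge 3$ and $n\ge 3$ be integers and let $G$ be the complete bipartite graph $K_{m,n}$. Then $\mu(G)=m+n-2$.
   Context: For a graph $G=(V,E)$ (finite, simple, undirected) and $P\subseteq V$, two vertices $u,v\in P$ are mutually visible if there is a shortest $(u,v)$-path in $G$ containing no vertex of $P$ other than $u$ and $v$. $P$ is a mutual-visibility set of $G$ if its vertices are pairwise mutually visible. The mutual-visibility number $\mu(G)$ is the maximum cardinality of a mutual-visibility set of $G$. *)

theory Defs
  imports "Graph_Theory.Graph_Theory"
begin

text \<open>
  Finite simple undirected graphs are the symmetric, loop-free digraphs without parallel arcs of
  the locale \<^locale>\<open>graph\<close>: an edge is represented by its two opposite arcs.
\<close>

context pre_digraph
begin

definition shortest_apath :: "'a \<Rightarrow> 'b awalk \<Rightarrow> 'a \<Rightarrow> bool" where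
  "shortest_apath u p v \<longleftrightarrow> apath u p v \<and> (\<forall>q. apath u q v \<longrightarrow> length p \<le> length q)"

definition mutually_visible :: "'a set \<Rightarrow> 'a \<Rightarrow> 'a \<Rightarrow> bool" where
  "mutually_visible P u v \<longleftrightarrow>
     (\<exists>p. shortest_apath u p v \<and> set (awalk_verts u p) \<inter> P \<subseteq> {u, v})"

text \<open>
  \<^const>\<open>pairwise\<close> ranges over distinct vertices only; this is immaterial, since every vertex is
  mutually visible with itself via the trivial path.
\<close>

definition mutual_visibility_set :: "'a set \<Rightarrow> bool" where
  "mutual_visibility_set P \<longleftrightarrow> P \<subseteq> verts G \<and> pairwise (mutually_visible P) P"

text \<open>
  For finite \<^term>\<open>G\<close> the maximum is over a finite set, nonempty because the empty set is a
  mutual-visibility set.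
\<close>

definition mutual_visibility_number :: nat where
  "mutual_visibility_number = Max (card ` {P. mutual_visibility_set P})"

end

end

theory Submission
  imports Defs
begin

text \<open>
  Adjacent vertices always see each other, and two vertices on the same side see each other iff
  the other side is not contained in \<open>P\<close>. So omitting one vertex from each side gives a
  mutual-visibility set, whereas a mutual-visibility set containing a whole side has at most one
  vertex on the other side.
\<close>

context wf_digraph
begin

text \<open>A single arc is a path without interior vertices, so \<open>P\<close> cannot block it.
  It is shortest because the empty walk would force \<open>u = v\<close>.\<close>

lemma mutually_visible_if_adj:
  assumes "u \<rightarrow> v" "u \<noteq> v"
  shows "mutually_visible P u v"
proof -
  obtain e where e: "e \<in> arcs G" "tail G e = u" "head G e = v"
    using assms(1) by (auto simp: arcs_ends_conv)
  have "apath u [e] v"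
    using e assms(2) by (auto simp: apath_simps)
  moreover have "1 \<le> length q" if "apath u q v" for q
    using that assms(2) by (cases q) (auto simp: apath_simps)
  ultimately have "shortest_apath u [e] v"
    by (auto simp: shortest_apath_def)
  then show ?thesis
    using e unfolding mutually_visible_def by (intro exI[of _ "[e]"]) auto
qed

lemma apath_length_ge_2:
  assumes "apath u p v" "u \<noteq> v" "\<not> u \<rightarrow> v"
  shows "2 \<le> length p"
proof (rule ccontr)
  assume "\<not> 2 \<le> length p"
  then consider "p = []" | e where "p = [e]"
    by (cases p; cases "tl p") auto
  then show False
    using assms by cases (auto simp: apath_simps arcs_ends_conv)
qed

text \<open>Loops are possible in this locale, so non-adjacency is what makes the three vertices
  distinct: if \<open>w\<close> were \<open>u\<close> or \<open>v\<close>, one of the two given arcs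
  would join \<open>u\<close> to \<open>v\<close>.\<close>

lemma apath_via:
  assumes "u \<rightarrow> w" "w \<rightarrow> v" "u \<noteq> v" "\<not> u \<rightarrow> v"
  obtains p where "apath u p v" "length p = 2" "awalk_verts u p = [u, w, v]"
proof -
  obtain e f where "e \<in> arcs G" "tail G e = u" "head G e = w"
      and "f \<in> arcs G" "tail G f = w" "head G f = v"
    using assms(1,2) by (auto simp: arcs_ends_conv)
  moreover have "w \<noteq> u" "w \<noteq> v"
    using assms by auto
  ultimately show thesis
    using assms(3) by (intro that[of "[e, f]"]) (auto simp: apath_simps)
qed

lemma mutually_visible_if_common_neighbour:
  assumes "u \<rightarrow> w" "w \<rightarrow> v" "u \<noteq> v" "\<not> u \<rightarrow> v" "w \<notin> P"
  shows "mutually_visible P u v"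
proof -
  obtain p where p: "apath u p v" "length p = 2" "awalk_verts u p = [u, w, v]"
    using apath_via assms(1-4) by metis
  then have "shortest_apath u p v"
    using assms(3,4) by (auto simp: shortest_apath_def intro: apath_length_ge_2)
  then show ?thesis
    using p(3) assms(5) unfolding mutually_visible_def by (intro exI[of _ p]) auto
qed

text \<open>The vertex \<open>x\<close> may lie in \<open>P\<close>; it only shows that the distance
  from \<open>u\<close> to \<open>v\<close> is 2. The vertex \<open>w\<close> is then the midpoint
  of a shortest path witnessing visibility.\<close>

lemma common_neighbour_if_mutually_visible:
  assumes "mutually_visible P u v" "u \<noteq> v" "\<not> u \<rightarrow> v" "u \<rightarrow> x" "x \<rightarrow> v"
  obtains w where "u \<rightarrow> w" "w \<rightarrow> v" "w \<notin> P"
proof -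
  obtain p where p: "shortest_apath u p v" "set (awalk_verts u p) \<inter> P \<subseteq> {u, v}"
    using assms(1) by (auto simp: mutually_visible_def)
  obtain q where "apath u q v" "length q = 2"
    using apath_via assms(2-5) by metis
  \<comment> \<open>Minimality of \<open>p\<close> against \<open>q\<close> gives at most 2,
    non-adjacency gives at least 2.\<close>
  with p(1) have "length p = 2"
    using assms(2,3) apath_length_ge_2 unfolding shortest_apath_def by (metis le_antisym)
  then obtain e f where ef: "p = [e, f]"
    by (auto simp: numeral_2_eq_2 length_Suc_conv)
  have "apath u [e, f] v"
    using p(1) ef by (simp add: shortest_apath_def)
  then have "e \<in> arcs G" "tail G e = u" "f \<in> arcs G" "tail G f = head G e" "head G f = v"
    and neq: "head G e \<noteq> u" "head G e \<noteq> v"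
    by (auto simp: apath_simps)
  then have "u \<rightarrow> head G e" "head G e \<rightarrow> v"
    by (metis in_arcs_imp_in_arcs_ends)+
  \<comment> \<open>On this path only \<open>u\<close> and \<open>v\<close> may belong to
    \<open>P\<close>, and the midpoint is neither of them.\<close>
  moreover have "head G e \<notin> P"
    using p(2) neq \<open>apath u [e, f] v\<close> by (auto simp: ef apath_simps)
  ultimately show thesis
    using that by blast
qed

end

context fin_digraph
begin

lemma finite_mutual_visibility_sets: "finite {P. mutual_visibility_set P}"
  by (rule finite_subset[of _ "Pow (verts G)"]) (auto simp: mutual_visibility_set_def)

text \<open>Two distinct vertices of \<open>P\<close> in \<open>V\<close> would need a common
  neighbour outside \<open>P\<close>, but all their neighbours lie in \<open>U\<close>, hence in
  \<open>P\<close>.\<close>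

lemma complete_bipartite_opposite_card_le:
  assumes UV: "verts G = U \<union> V" "U \<inter> V = {}" "arcs_ends G = U \<times> V \<union> V \<times> U"
    and "U \<noteq> {}" "mutual_visibility_set P" "U \<subseteq> P"
  shows "card (P \<inter> V) \<le> 1"
proof -
  have "a = b" if "a \<in> P \<inter> V" "b \<in> P \<inter> V" for a b
  proof (rule ccontr)
    assume "a \<noteq> b"
    then have "mutually_visible P a b"
      using that assms(5) by (auto simp: mutual_visibility_set_def pairwise_def)
    moreover obtain x where "x \<in> U"
      using \<open>U \<noteq> {}\<close> by blast
    then have "\<not> a \<rightarrow> b" "a \<rightarrow> x" "x \<rightarrow> b"
      using that UV by auto
    ultimately obtain w where "a \<rightarrow> w" "w \<notin> P"
      using \<open>a \<noteq> b\<close> common_neighbour_if_mutually_visible by metis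
    then show False
      using that UV \<open>U \<subseteq> P\<close> by auto
  qed
  moreover have "finite (P \<inter> V)"
    using finite_verts UV(1) by simp
  ultimately show ?thesis
    by (auto simp: card_le_Suc0_iff_eq)
qed

text \<open>Two vertices on one side see each other through the omitted vertex of the other
  side.\<close>

lemma complete_bipartite_mutual_visibility_set:
  assumes UV: "verts G = U \<union> V" "U \<inter> V = {}" "arcs_ends G = U \<times> V \<union> V \<times> U"
    and "u \<in> U" "v \<in> V"
  shows "mutual_visibility_set (verts G - {u, v})"
  unfolding mutual_visibility_set_def pairwise_def
proof (intro conjI ballI impI)
  let ?P = "verts G - {u, v}"
  fix a b assume ab: "a \<in> ?P" "b \<in> ?P" "a \<noteq> b"
  then consider "a \<rightarrow> b" | "a \<in> U" "b \<in> U" | "a \<in> V" "b \<in> V"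
    using UV by auto
  then show "mutually_visible ?P a b"
  proof cases
    case 1
    then show ?thesis
      using ab by (blast intro: mutually_visible_if_adj)
  next
    case 2
    then show ?thesis
      using ab UV \<open>v \<in> V\<close> by (intro mutually_visible_if_common_neighbour[of a v b]) auto
  next
    case 3
    then show ?thesis
      using ab UV \<open>u \<in> U\<close> by (intro mutually_visible_if_common_neighbour[of a u b]) auto
  qed
qed auto

lemma complete_bipartite_card_mutual_visibility_set_le:
  assumes UV: "verts G = U \<union> V" "U \<inter> V = {}" "arcs_ends G = U \<times> V \<union> V \<times> U"
    and "card U \<ge> 3" "card V \<ge> 3" "mutual_visibility_set P"
  shows "card P \<le> card U + card V - 2"
proof -
  have fin: "finite U" "finite V" and ne: "U \<noteq> {}" "V \<noteq> {}"
    using finite_verts UV(1) assms(4,5) by auto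
  have "P = (P \<inter> U) \<union> (P \<inter> V)"
    using UV(1) assms(6) by (auto simp: mutual_visibility_set_def)
  moreover have "card ((P \<inter> U) \<union> (P \<inter> V)) = card (P \<inter> U) + card (P \<inter> V)"
    using fin UV(2) by (intro card_Un_disjoint) auto
  ultimately have "card P = card (P \<inter> U) + card (P \<inter> V)"
    by simp
  moreover have le: "card (P \<inter> U) \<le> card U" "card (P \<inter> V) \<le> card V"
    using fin by (auto intro: card_mono)
  moreover have "card (P \<inter> V) \<le> 1" if "U \<subseteq> P"
    using complete_bipartite_opposite_card_le[OF UV ne(1) assms(6) that] .
  moreover have "card (P \<inter> U) \<le> 1" if "V \<subseteq> P"
    using complete_bipartite_opposite_card_le[of V U P] UV ne(2) assms(6) that by blast
  moreover have "card (P \<inter> U) < card U" if "\<not> U \<subseteq> P"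
    using that fin by (intro psubset_card_mono) auto
  moreover have "card (P \<inter> V) < card V" if "\<not> V \<subseteq> P"
    using that fin by (intro psubset_card_mono) auto
  \<comment> \<open>If \<open>P\<close> misses a vertex on each side, the bound is immediate. If it
    contains just one side, say \<open>U\<close>, it has at most \<open>card U + 1\<close> elements,
    and \<open>card V \<ge> 3\<close> absorbs the 1. It cannot contain both sides, since then
    \<open>card V \<le> 1\<close>.\<close>
  ultimately show ?thesis
    using assms(4,5) by linarith
qed

end

theorem theorem4p9:
  fixes G :: "('a, 'b) pre_digraph" and m n :: nat
  assumes "m \<ge> 3" and "n \<ge> 3"
    and "complete_bipartite_digraph m n G"
  shows "pre_digraph.mutual_visibility_number G = m + n - 2"
proof -
  interpret graph G
    using assms(3) by (simp add: complete_bipartite_digraph_def)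
  obtain U V where UV: "verts G = U \<union> V" "U \<inter> V = {}" "arcs_ends G = U \<times> V \<union> V \<times> U"
      and card: "card U = m" "card V = n"
    using assms(3) by (auto simp: complete_bipartite_digraph_def)
  have "U \<noteq> {}" "V \<noteq> {}"
    using card assms(1,2) by auto
  then obtain u v where uv: "u \<in> U" "v \<in> V"
    by blast
  have "card (verts G) = m + n"
    using finite_verts UV(1,2) card by (simp add: card_Un_disjoint)
  moreover have "u \<noteq> v"
    using uv UV(2) by blast
  ultimately have "card (verts G - {u, v}) = m + n - 2"
    using uv UV(1) by (simp add: card_Diff_subset)
  moreover have "mutual_visibility_set (verts G - {u, v})"
    using complete_bipartite_mutual_visibility_set[OF UV uv] .
  ultimately have "m + n - 2 \<in> card ` {P. mutual_visibility_set P}"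
    by (metis imageI mem_Collect_eq)
  moreover have "card P \<le> m + n - 2" if "mutual_visibility_set P" for P
    using complete_bipartite_card_mutual_visibility_set_le[OF UV _ _ that] card assms(1,2) by simp
  \<comment> \<open>The value is attained and is an upper bound; finiteness of the family of sets
    makes \<open>Max\<close> the true maximum.\<close>
  ultimately show ?thesis
    unfolding mutual_visibility_number_def
    by (intro Max_eqI) (auto simp: finite_mutual_visibility_sets)
qed

end
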